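(* Let $0<p<1$. Then the functions $f$ and $g$ defined on the open unit disk $\mathbb{D}$ by $$f(z)=\frac{1+z}{1-z},\qquad g(z)=-f(-z)=-\frac{1-z}{1+z}$$ both belong to the Hardy space $H^p$ but fail to satisfy the triangle inequality for $\|\cdot\|_{H^p}$; that is, $\|f+g\|_{H^p}>\|f\|_{H^p}+\|g\|_{H^p}$.
   Context: $\mathbb{D}=\{z\in\mathbb{C}:|z|<1\}$. For $f$ analytic in $\mathbb{D}$, $0<p<\infty$ and $0<r<1$, let $M_p(r;f)=\left(\int_0^{2\pi}|f(re^{i\theta})|^p\,\frac{d\theta}{2\pi}\right)^{1/p}$, which is an increasing function of $r$. The Hardy space $H^p$ is the set of all $f$ analytic in $\mathbb{D}$ with $\|f\|_{H^p}=\lim_{r\to1^-}M_p(r;f)<\infty$. The notation $\|\cdot\|_{H^p}$ is used also for $0<p<1$, although it need not be a norm. *)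

theory Defs
  imports "HOL-Complex_Analysis.Complex_Analysis"
begin

definition integral_mean :: "real \<Rightarrow> real \<Rightarrow> (complex \<Rightarrow> complex) \<Rightarrow> real" where
  "integral_mean p r f =
     (1 / (2 * pi) * integral {0..2 * pi} (\<lambda>\<theta>. norm (f (of_real r * cis \<theta>)) powr p)) powr (1 / p)"

text \<open>
  The limit is taken in the extended nonnegative reals, where it exists for every function
  holomorphic on the unit disk, because the integral means increase with the radius.
\<close>

definition hardy_norm :: "real \<Rightarrow> (complex \<Rightarrow> complex) \<Rightarrow> ennreal" where
  "hardy_norm p f = Lim (at_left 1) (\<lambda>r. ennreal (integral_mean p r f))"

definition hardy_space :: "real \<Rightarrow> (complex \<Rightarrow> complex) set" where
  "hardy_space p = {f. f holomorphic_on ball 0 1 \<and> hardy_norm p f < \<infinity>}"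

end

theory Submission
  imports Defs
begin

text \<open>
  On the unit circle, \<open>|f(e\<^sup>i\<^sup>x)| = |cot (x/2)|\<close>, while
  \<open>f z + g z = 4 z / (1 - z\<^sup>2)\<close> has modulus \<open>2 / |sin x|\<close>. Since \<open>g\<close> is a rotation of \<open>f\<close>
  up to sign, the two have the same norm, and the claim is \<open>\<parallel>f + g\<parallel> > 2 \<parallel>f\<parallel>\<close>.
  Replacing \<open>z\<^sup>2\<close> by \<open>w\<close> does not change the mean over the unit circle, and so
  \<open>\<parallel>f + g\<parallel>\<close> is also the norm of \<open>4 / (1 - w)\<close>, to be compared with that of
  \<open>2 f(w) = 2 (1 + w) / (1 - w)\<close>. Both quotients have the same denominator, and \<open>|2 (1 + w)| < 4\<close>
  on the circle except at \<open>w = 1\<close>. This is \<open>boundary_mean_less\<close>.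

  The norms are limits of means over circles of radius \<open>r < 1\<close>. That they may be computed on the
  unit circle itself is where \<open>p < 1\<close> enters: by dominated convergence it suffices that
  \<open>|1 - e\<^sup>i\<^sup>x|\<^sup>-\<^sup>p\<close>, which grows like \<open>|x|\<^sup>-\<^sup>p\<close> near \<open>0\<close>, is integrable. This is
  \<open>integral_mean_tendsto_boundary\<close>, which also gives finiteness of the norms. The symmetries are
  \<open>integral_mean_reflect\<close> and \<open>integral_mean_compose_square\<close>, which need only be proved for
  \<open>r < 1\<close>, where all integrands are continuous.
\<close>

section \<open>Integrability of the boundary singularity\<close>

text \<open>The graph of the concave function \<open>sin\<close> lies above its chord on \<open>[0, \<pi>/2]\<close>.\<close>

lemma jordan_inequality:
  fixes x :: real
  assumes "0 \<le> x" "x \<le> pi / 2"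
  shows "2 * x / pi \<le> sin x"
proof -
  have "convex_on {0..pi/2} (\<lambda>x. - sin x)"
  proof (rule f''_ge0_imp_convex)
    show "((\<lambda>x. - sin x) has_real_derivative - cos x) (at x)" for x :: real
      by (auto intro!: derivative_eq_intros)
    show "((\<lambda>x. - cos x) has_real_derivative sin x) (at x)" for x :: real
      by (auto intro!: derivative_eq_intros)
    show "sin x \<ge> 0" if "x \<in> {0..pi/2}" for x :: real
      using that by (intro sin_ge_zero) auto
  qed auto
  from convex_onD[OF this, of "2 * x / pi" 0 "pi / 2"] assms show ?thesis
    by (simp add: field_simps)
qed

lemma norm_one_minus_cis: "norm (1 - cis x) = 2 * \<bar>sin (x / 2)\<bar>"
proof -
  have "(norm (1 - cis x))\<^sup>2 = (1 - cos x)\<^sup>2 + (sin x)\<^sup>2"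
    by (simp add: cmod_power2)
  also have "\<dots> = 2 - 2 * cos x"
    using sin_cos_squared_add[of x] by (simp add: power2_eq_square algebra_simps)
  also have "\<dots> = (2 * \<bar>sin (x / 2)\<bar>)\<^sup>2"
    using cos_double_sin[of "x / 2"] by (simp add: power_mult_distrib)
  finally show ?thesis
    by (rule power2_eq_imp_eq) auto
qed

lemma one_minus_cis_nonzero:
  assumes "x \<in> {0<..<2 * pi}"
  shows "1 - cis x \<noteq> 0"
proof -
  have "sin (x / 2) > 0"
    using assms by (intro sin_gt_zero) auto
  hence "norm (1 - cis x) > 0"
    by (simp add: norm_one_minus_cis)
  thus ?thesis by auto
qed

text \<open>
  Near either end of the interval, \<open>|1 - e\<^sup>i\<^sup>x|\<close> is at least a multiple of the distance to that end,
  so the sum of the two corresponding powers is an integrable majorant.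
\<close>

lemma inverse_norm_one_minus_cis_powr_integrable:
  assumes "0 < p" "p < 1"
  shows "(\<lambda>x. norm (1 - cis x) powr - p) integrable_on {0<..<2 * pi}"
proof -
  define h where "h x = (2 / pi) powr - p * (x powr - p + (2 * pi - x) powr - p)" for x :: real
  have left: "(\<lambda>x. x powr - p) integrable_on {0..2 * pi}"
    using assms by (intro integrable_on_powr_from_0) auto
  have right: "(\<lambda>x. (2 * pi - x) powr - p) integrable_on {0..2 * pi}"
    using integrable_affinity[of "\<lambda>x. x powr - p" 0 "2 * pi" "-1" "2 * pi"] left by simp
  have "h integrable_on {0..2 * pi}"
    unfolding h_def using left right
    by (intro integrable_on_mult_right integrable_add)
  hence h: "h integrable_on {0<..<2 * pi}"
    by (simp add: integrable_on_open_interval_real)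
  have bound: "norm (1 - cis x) powr - p \<le> h x" if x: "x \<in> {0<..<2 * pi}" for x
  proof (cases "x \<le> pi")
    case True
    have "2 / pi * x \<le> norm (1 - cis x)"
      using jordan_inequality[of "x / 2"] True x by (simp add: norm_one_minus_cis)
    hence "norm (1 - cis x) powr - p \<le> (2 / pi * x) powr - p"
      using x assms by (intro powr_mono2') auto
    also have "\<dots> \<le> h x"
      using x by (simp add: h_def powr_mult distrib_left del: times_divide_eq_left)
    finally show ?thesis .
  next
    case False
    have "sin (x / 2) = sin ((2 * pi - x) / 2)"
      using sin_pi_minus[of "x / 2"] by (simp add: diff_divide_distrib)
    hence "2 / pi * (2 * pi - x) \<le> norm (1 - cis x)"
      using jordan_inequality[of "(2 * pi - x) / 2"] False x by (simp add: norm_one_minus_cis)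
    hence "norm (1 - cis x) powr - p \<le> (2 / pi * (2 * pi - x)) powr - p"
      using x assms by (intro powr_mono2') auto
    also have "\<dots> \<le> h x"
      using x by (simp add: h_def powr_mult distrib_left del: times_divide_eq_left)
    finally show ?thesis .
  qed
  show ?thesis
  proof (rule measurable_bounded_by_integrable_imp_integrable[OF _ h])
    have "continuous_on {0<..<2 * pi} (\<lambda>x. norm (1 - cis x) powr - p)"
      using one_minus_cis_nonzero by (intro continuous_intros) auto
    thus "(\<lambda>x. norm (1 - cis x) powr - p) \<in> borel_measurable (lebesgue_on {0<..<2 * pi})"
      by (intro continuous_imp_measurable_on_sets_lebesgue) auto
  qed (use bound in auto)
qed

section \<open>Means over circles approaching the unit circle\<close>

text \<open>
  This bounds \<open>1 / |1 - r e\<^sup>i\<^sup>x|\<close> uniformly in \<open>r\<close> by twice its boundary value. The reason is that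
  \<open>r e\<^sup>i\<^sup>x\<close> lies within \<open>1 - r\<close> of \<open>e\<^sup>i\<^sup>x\<close>, and \<open>1 - r\<close> is itself at most \<open>|1 - r e\<^sup>i\<^sup>x|\<close>.
\<close>

lemma norm_one_minus_cis_le:
  assumes "0 \<le> r" "r \<le> 1"
  shows "norm (1 - cis x) \<le> 2 * norm (1 - of_real r * cis x)"
proof -
  have "1 - r = norm (1 :: complex) - norm (of_real r * cis x)"
    using assms by (simp add: norm_mult)
  also have "\<dots> \<le> norm (1 - of_real r * cis x)"
    by (rule norm_triangle_ineq2)
  finally have "1 - r \<le> norm (1 - of_real r * cis x)" .
  moreover have "norm (1 - cis x) \<le> norm (1 - of_real r * cis x) + norm ((of_real r - 1) * cis x)"
    by (rule order.trans[OF _ norm_triangle_ineq]) (simp add: algebra_simps)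
  moreover have "norm ((of_real r - 1) * cis x) = 1 - r"
    using assms norm_of_real[of "r - 1", where ?'a = complex] by (simp add: norm_mult)
  ultimately show ?thesis by linarith
qed

text \<open>
  Dominated convergence, with a multiple of \<open>|1 - e\<^sup>i\<^sup>x|\<^sup>-\<^sup>p\<close> as majorant. The limit is again an
  integral mean, at radius \<open>1\<close>, where the value at the pole is immaterial: the proof works on the
  open interval from \<open>0\<close> to \<open>2\<pi>\<close>, which leaves out the angles of the pole.
\<close>

lemma integral_mean_tendsto_boundary:
  assumes p: "0 < p" "p < 1" and u: "continuous_on (cball 0 1) u"
  defines "h \<equiv> \<lambda>z. u z / (1 - z)"
  shows "(\<lambda>x. norm (h (cis x)) powr p) integrable_on {0..2 * pi}"
    and "((\<lambda>r. integral_mean p r h) \<longlongrightarrow> integral_mean p 1 h) (at_left 1)"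
proof -
  define F where "F r x = norm (h (of_real r * cis x)) powr p" for r x
  obtain C where C: "C > 0" "\<And>z. z \<in> cball 0 1 \<Longrightarrow> norm (u z) \<le> C"
    using compact_continuous_image[OF u compact_cball]
    by (metis bounded_pos compact_imp_bounded imageI)
  have dom: "norm (F r x) \<le> (2 * C) powr p * norm (1 - cis x) powr - p"
    if r: "0 \<le> r" "r \<le> 1" and x: "x \<in> {0<..<2 * pi}" for r x
  proof -
    have "of_real r * cis x \<in> cball 0 1"
      using r by (simp add: norm_mult)
    hence "norm (h (of_real r * cis x)) \<le> C / norm (1 - of_real r * cis x)"
      using C by (auto simp: h_def norm_divide intro!: divide_right_mono)
    also have "\<dots> \<le> C / (norm (1 - cis x) / 2)"
    proof (rule divide_left_mono)
      have "norm (1 - cis x) > 0"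
        using one_minus_cis_nonzero[OF x] by simp
      thus "0 < norm (1 - of_real r * cis x) * (norm (1 - cis x) / 2)"
        using norm_one_minus_cis_le[OF r, of x] by (intro mult_pos_pos) linarith+
    qed (use C(1) norm_one_minus_cis_le[OF r, of x] in auto)
    finally have "norm (h (of_real r * cis x)) \<le> 2 * C / norm (1 - cis x)"
      by (simp add: mult.commute)
    hence "F r x \<le> (2 * C / norm (1 - cis x)) powr p"
      unfolding F_def using p by (intro powr_mono2) auto
    also have "\<dots> = (2 * C) powr p * norm (1 - cis x) powr - p"
      using C(1) by (simp add: powr_divide powr_minus divide_simps)
    finally show ?thesis by (simp add: F_def)
  qed
  have dom_int: "(\<lambda>x. (2 * C) powr p * norm (1 - cis x) powr - p) integrable_on {0<..<2 * pi}"
    using inverse_norm_one_minus_cis_powr_integrable[OF p] by (rule integrable_on_mult_right)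
  have F_int: "F r integrable_on {0<..<2 * pi}" if r: "0 < r" "r < 1" for r
  proof -
    have "of_real r * cis x \<noteq> 1" for x
    proof
      assume "of_real r * cis x = 1"
      hence "norm (of_real r * cis x) = 1" by simp
      with r show False by (simp add: norm_mult)
    qed
    hence "continuous_on {0..2 * pi} (F r)"
      unfolding F_def h_def using p r
      by (intro continuous_intros continuous_on_powr' continuous_on_compose2[OF u])
         (auto simp: norm_mult)
    thus ?thesis
      by (simp add: integrable_on_open_interval_real integrable_continuous_real)
  qed
  have F_lim: "((\<lambda>r. F r x) \<longlongrightarrow> F 1 x) (at_left 1)" if x: "x \<in> {0<..<2 * pi}" for x
  proof -
    have "continuous_on {0..1} (\<lambda>r. F r x)"
    proof -
      have "1 - of_real r * cis x \<noteq> 0" if "r \<in> {0..1}" for r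
        using norm_one_minus_cis_le[of r x] that one_minus_cis_nonzero[OF x] by auto
      thus ?thesis
        unfolding F_def h_def using p
        by (intro continuous_intros continuous_on_powr' continuous_on_compose2[OF u])
           (auto simp: norm_mult)
    qed
    hence "((\<lambda>r. F r x) \<longlongrightarrow> F 1 x) (at 1 within {0..1})"
      by (simp add: continuous_on_def)
    thus ?thesis
      by (simp add: at_within_Icc_at_left)
  qed
  have lim: "F 1 integrable_on {0<..<2 * pi} \<and>
      (\<lambda>n. integral {0<..<2 * pi} (F (s n))) \<longlonglongrightarrow> integral {0<..<2 * pi} (F 1)"
    if s: "\<And>n. 0 < s n" "\<And>n. s n < 1" "s \<longlonglongrightarrow> 1" for s
  proof -
    have "filterlim s (at_left 1) sequentially"
      using s by (auto simp: filterlim_at less_imp_neq intro!: always_eventually)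
    hence conv: "(\<lambda>n. F (s n) x) \<longlonglongrightarrow> F 1 x" if "x \<in> {0<..<2 * pi}" for x
      using F_lim[OF that] by (rule filterlim_compose[rotated])
    show ?thesis
      using dominated_convergence[of "\<lambda>n. F (s n)", OF F_int dom_int dom conv] s
      by (auto simp: less_imp_le)
  qed
  \<comment> \<open>Any sequence of radii that increases to \<open>1\<close> yields integrability of the boundary function.\<close>
  have "(\<lambda>n. 1 - 1 / (real n + 2)) \<longlonglongrightarrow> 1"
    by real_asymp
  with lim[of "\<lambda>n. 1 - 1 / (real n + 2)"] have "F 1 integrable_on {0<..<2 * pi}"
    by (auto simp: field_simps)
  thus "(\<lambda>x. norm (h (cis x)) powr p) integrable_on {0..2 * pi}"
    by (simp add: F_def[abs_def] integrable_on_open_interval_real)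
  have "((\<lambda>r. integral {0<..<2 * pi} (F r)) \<longlongrightarrow> integral {0<..<2 * pi} (F 1)) (at_left 1)"
    by (rule tendsto_at_left_sequentially[of 0]) (use lim in auto)
  hence "((\<lambda>r. integral {0..2 * pi} (F r)) \<longlongrightarrow> integral {0..2 * pi} (F 1)) (at_left 1)"
    by (simp add: integral_open_interval_real)
  \<comment> \<open>If the limit integral vanishes, the base of the outer power tends to \<open>0\<close> and must be nonnegative.\<close>
  moreover have "integral {0..2 * pi} (F r) \<ge> 0" for r
    by (cases "F r integrable_on {0..2 * pi}")
       (auto simp: F_def not_integrable_integral intro!: integral_nonneg)
  ultimately show "((\<lambda>r. integral_mean p r h) \<longlongrightarrow> integral_mean p 1 h) (at_left 1)"
    unfolding integral_mean_def F_def[symmetric] using p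
    by (intro tendsto_powr' tendsto_intros) auto
qed

section \<open>Symmetries of integral means\<close>

lemma integral_periodic_shift:
  fixes k :: "real \<Rightarrow> real"
  assumes k: "continuous_on UNIV k" and per: "\<And>x. k (x + 2 * pi) = k x"
  shows "integral {0..2 * pi} (\<lambda>x. k (x + pi)) = integral {0..2 * pi} k"
proof -
  have int: "k integrable_on {a..b}" for a b
    using continuous_on_subset[OF k] by (intro integrable_continuous_real) auto
  have "integral {0..2 * pi} (\<lambda>x. k (x + pi)) = integral {pi..3 * pi} k"
    using integral_shift_real_ivl[of pi pi "3 * pi" k] by simp
  also have "\<dots> = integral {pi..2 * pi} k + integral {2 * pi..3 * pi} k"
    by (rule Henstock_Kurzweil_Integration.integral_combine[symmetric]) (use int in auto)
  also have "integral {2 * pi..3 * pi} k = integral {0..pi} k"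
    using integral_shift_real_ivl[of "2 * pi" "2 * pi" "3 * pi" k] by (simp add: per)
  also have "integral {pi..2 * pi} k + integral {0..pi} k = integral {0..2 * pi} k"
    using Henstock_Kurzweil_Integration.integral_combine[of 0 pi "2 * pi" k] int by simp
  finally show ?thesis .
qed

lemma integral_periodic_double:
  fixes k :: "real \<Rightarrow> real"
  assumes k: "continuous_on UNIV k" and per: "\<And>x. k (x + 2 * pi) = k x"
  shows "integral {0..2 * pi} (\<lambda>x. k (2 * x)) = integral {0..2 * pi} k"
proof -
  have int: "k integrable_on {a..b}" for a b
    using continuous_on_subset[OF k] by (intro integrable_continuous_real) auto
  have "integral {0..2 * pi} (\<lambda>x. k (2 * x)) = integral {0..4 * pi} k / 2"
    using integral_stretch_real[of 2 0 "4 * pi" k] by simp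
  also have "integral {0..4 * pi} k = integral {0..2 * pi} k + integral {2 * pi..4 * pi} k"
    by (rule Henstock_Kurzweil_Integration.integral_combine[symmetric]) (use int in auto)
  also have "integral {2 * pi..4 * pi} k = integral {0..2 * pi} k"
    using integral_shift_real_ivl[of "2 * pi" "2 * pi" "4 * pi" k] by (simp add: per)
  finally show ?thesis by simp
qed


lemma integral_mean_cong:
  assumes "0 \<le> r" "\<And>z. norm z = r \<Longrightarrow> norm (f z) = norm (g z)"
  shows "integral_mean p r f = integral_mean p r g"
proof -
  have "norm (f (of_real r * cis x)) = norm (g (of_real r * cis x))" for x
    using assms by (intro assms(2)) (simp add: norm_mult)
  thus ?thesis by (simp add: integral_mean_def)
qed

lemma integral_mean_cmult:
  assumes "0 < p"
  shows "integral_mean p r (\<lambda>z. c * f z) = norm c * integral_mean p r f"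
proof -
  define I where "I = 1 / (2 * pi) * integral {0..2 * pi} (\<lambda>x. norm (f (of_real r * cis x)) powr p)"
  have "integral_mean p r (\<lambda>z. c * f z) = (norm c powr p * I) powr (1 / p)"
    by (simp add: integral_mean_def I_def norm_mult powr_mult)
  also have "\<dots> = norm c * I powr (1 / p)"
    using assms by (simp add: powr_mult powr_powr)
  finally show ?thesis
    by (simp add: integral_mean_def I_def)
qed

lemma continuous_on_circle_powr:
  assumes "0 < p" "0 \<le> r" "r < 1" "continuous_on (ball 0 1) f"
  shows "continuous_on UNIV (\<lambda>x. norm (f (of_real r * cis x)) powr p)"
  using assms
  by (intro continuous_on_powr' continuous_on_compose2[OF assms(4)] continuous_intros)
     (auto simp: norm_mult)

lemma integral_mean_reflect:
  assumes "0 < p" "0 \<le> r" "r < 1" "continuous_on (ball 0 1) f"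
  shows "integral_mean p r (\<lambda>z. f (- z)) = integral_mean p r f"
proof -
  have "cis (x + pi) = - cis x" "cis (x + 2 * pi) = cis x" for x
    by (simp_all flip: cis_mult)
  thus ?thesis
    using integral_periodic_shift[OF continuous_on_circle_powr[OF assms]]
    by (simp add: integral_mean_def)
qed

lemma integral_mean_compose_square:
  assumes "0 < p" "0 \<le> r" "r < 1" "continuous_on (ball 0 1) f"
  shows "integral_mean p r (\<lambda>z. f (z\<^sup>2)) = integral_mean p (r\<^sup>2) f"
proof -
  have "cis (x + 2 * pi) = cis x" for x
    by (simp flip: cis_mult)
  moreover have "r\<^sup>2 < 1"
    using assms by (simp add: power_less_one_iff abs_square_less_1)
  moreover have "(of_real r * cis x)\<^sup>2 = of_real (r\<^sup>2) * cis (2 * x)" for x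
    by (simp add: power_mult_distrib power2_eq_square[of "cis x"] cis_mult)
  ultimately show ?thesis
    using integral_periodic_double[OF continuous_on_circle_powr[of p "r\<^sup>2" f]] assms
    by (simp add: integral_mean_def)
qed

section \<open>Comparison of the norms\<close>

lemma hardy_norm_eqI:
  assumes "((\<lambda>r. integral_mean p r f) \<longlongrightarrow> L) (at_left 1)"
  shows "hardy_norm p f = ennreal L"
  unfolding hardy_norm_def using assms by (intro tendsto_Lim tendsto_ennrealI) auto

text \<open>
  With the factor \<open>2\<close> moved inside, the integrands are \<open>|2 (1 + e\<^sup>i\<^sup>x)|\<^sup>p\<close> and \<open>4\<^sup>p\<close>, both divided by
  \<open>|1 - e\<^sup>i\<^sup>x|\<^sup>p\<close>. To get a strict inequality of integrals although the integrands are unbounded, note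
  that \<open>|1 - e\<^sup>i\<^sup>x| \<le> 2\<close>, so that their difference is at least the continuous function
  \<open>2\<^sup>p - |1 + e\<^sup>i\<^sup>x|\<^sup>p\<close>, which is nonnegative and not identically zero.
\<close>

lemma boundary_mean_less:
  assumes p: "0 < p" "p < 1"
  shows "2 * integral_mean p 1 (\<lambda>z. (1 + z) / (1 - z)) < integral_mean p 1 (\<lambda>z. 4 / (1 - z))"
proof -
  let ?F = "\<lambda>x. norm (2 * (1 + cis x) / (1 - cis x)) powr p"
  let ?H = "\<lambda>x. norm (4 / (1 - cis x)) powr p"
  let ?d = "\<lambda>x. 2 powr p - norm (1 + cis x) powr p"
  have F: "?F integrable_on {0..2 * pi}"
    using integral_mean_tendsto_boundary(1)[OF p, of "\<lambda>z. 2 * (1 + z)"]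
    by (simp add: continuous_intros)
  have H: "?H integrable_on {0..2 * pi}"
    using integral_mean_tendsto_boundary(1)[OF p, of "\<lambda>z. 4"] by simp
  have le2: "norm (1 + cis x) \<le> 2" "norm (1 - cis x) \<le> 2" for x
    using norm_triangle_ineq[of 1 "cis x"] norm_triangle_ineq4[of 1 "cis x"] by simp_all
  have d_cont: "continuous_on {0..2 * pi} ?d"
    using p by (intro continuous_intros continuous_on_powr') auto
  have d_nonneg: "0 \<le> ?d x" for x
    using p le2 by (simp add: powr_mono2)
  have "integral {0..2 * pi} ?d \<noteq> 0"
  proof
    assume "integral {0..2 * pi} ?d = 0"
    hence "\<forall>x\<in>{0..2 * pi}. ?d x = 0"
      using integral_eq_0_iff[OF d_cont] d_nonneg by auto
    \<comment> \<open>At the angle \<open>\<pi>\<close>, \<open>1 + e\<^sup>i\<^sup>x\<close> vanishes.\<close>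
    from bspec[OF this, of pi] show False
      using p by simp
  qed
  moreover have "0 \<le> integral {0..2 * pi} ?d"
    using d_nonneg d_cont by (intro integral_nonneg integrable_continuous_real) auto
  ultimately have "0 < integral {0..2 * pi} ?d"
    by simp
  also have "\<dots> \<le> integral {0..2 * pi} (\<lambda>x. ?H x - ?F x)"
  proof (rule integral_le[OF _ integrable_diff[OF H F]])
    show "?d integrable_on {0..2 * pi}"
      using d_cont by (rule integrable_continuous_real)
    show "?d x \<le> ?H x - ?F x" for x
    proof (cases "cis x = 1")
      \<comment> \<open>At the pole both quotients are \<open>0\<close>, and so is the minorant.\<close>
      case True
      thus ?thesis by simp
    next
      case False
      have four: "(4 :: real) powr p = 2 powr p * 2 powr p"
        by (simp flip: powr_mult)
      have "?H x - ?F x = ?d x * (2 / norm (1 - cis x)) powr p"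
        unfolding norm_divide norm_mult
        by (simp add: powr_mult powr_divide four left_diff_distrib diff_divide_distrib)
      moreover have "1 \<le> (2 / norm (1 - cis x)) powr p"
        using False le2(2)[of x] p by (intro ge_one_powr_ge_zero) (auto simp: field_simps)
      ultimately show ?thesis
        using d_nonneg[of x] by (simp add: mult_le_cancel_left1)
    qed
  qed
  also have "\<dots> = integral {0..2 * pi} ?H - integral {0..2 * pi} ?F"
    using H F by (rule integral_diff)
  finally have "integral {0..2 * pi} ?F < integral {0..2 * pi} ?H"
    by simp
  moreover have "0 \<le> integral {0..2 * pi} ?F"
    using F by (intro integral_nonneg) auto
  ultimately have "integral_mean p 1 (\<lambda>z. 2 * (1 + z) / (1 - z)) < integral_mean p 1 (\<lambda>z. 4 / (1 - z))"
    unfolding integral_mean_def using p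
    by (intro powr_less_mono2) (auto simp: divide_strict_right_mono)
  thus ?thesis
    using integral_mean_cmult[OF p(1), of 1 2 "\<lambda>z. (1 + z) / (1 - z)"] by simp
qed

theorem theorem4:
  fixes p :: real and f g :: "complex \<Rightarrow> complex"
  assumes "0 < p" and "p < 1"
    and "\<And>z. z \<in> ball 0 1 \<Longrightarrow> f z = (1 + z) / (1 - z)"
    and "\<And>z. z \<in> ball 0 1 \<Longrightarrow> g z = - f (- z)"
  shows "(\<forall>z \<in> ball 0 1. g z = - ((1 - z) / (1 + z))) \<and>
    f \<in> hardy_space p \<and> g \<in> hardy_space p \<and>
    hardy_norm p (\<lambda>z. f z + g z) > hardy_norm p f + hardy_norm p g"
proof -
  note p = assms(1,2) and f = assms(3)
  let ?f = "\<lambda>z :: complex. (1 + z) / (1 - z)" and ?k = "\<lambda>z :: complex. 4 / (1 - z)"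
  let ?A = "integral_mean p 1 ?f" and ?B = "integral_mean p 1 ?k"
  have g: "g z = - ((1 - z) / (1 + z))" if "z \<in> ball 0 1" for z
    using that assms(3)[of "- z"] assms(4)[of z] by simp
  have nz: "1 - z \<noteq> 0" "1 + z \<noteq> 0" if "z \<in> ball 0 1" for z :: complex
    using that by (auto simp: add_eq_0_iff)
  have unit: "\<forall>\<^sub>F r in at_left (1 :: real). r \<in> {0<..<1}"
    by (rule eventually_at_left_real) simp
  have cont: "continuous_on (ball 0 1) ?f" "continuous_on (ball 0 1) ?k"
    using nz by (auto intro!: continuous_intros)
  have mean_f: "((\<lambda>r. integral_mean p r ?f) \<longlongrightarrow> ?A) (at_left 1)"
    using p by (intro integral_mean_tendsto_boundary(2) continuous_intros)
  have mean_k: "((\<lambda>r. integral_mean p r ?k) \<longlongrightarrow> ?B) (at_left 1)"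
    using p by (intro integral_mean_tendsto_boundary(2) continuous_intros)

  have norm_f: "hardy_norm p f = ennreal ?A"
  proof (rule hardy_norm_eqI, rule Lim_transform_eventually[OF mean_f])
    show "\<forall>\<^sub>F r in at_left 1. integral_mean p r ?f = integral_mean p r f"
      using unit
    proof eventually_elim
      case (elim r)
      thus ?case by (intro integral_mean_cong) (auto simp: f)
    qed
  qed
  have norm_g: "hardy_norm p g = ennreal ?A"
  proof (rule hardy_norm_eqI, rule Lim_transform_eventually[OF mean_f])
    show "\<forall>\<^sub>F r in at_left 1. integral_mean p r ?f = integral_mean p r g"
      using unit
    proof eventually_elim
      case (elim r)
      hence "integral_mean p r g = integral_mean p r (\<lambda>z. ?f (- z))"
        by (intro integral_mean_cong) (auto simp: g norm_divide)
      also have "\<dots> = integral_mean p r ?f"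
        using elim p by (intro integral_mean_reflect cont) auto
      finally show ?case ..
    qed
  qed
  have norm_sum: "hardy_norm p (\<lambda>z. f z + g z) = ennreal ?B"
  proof (rule hardy_norm_eqI)
    have "filterlim (\<lambda>r :: real. r\<^sup>2) (at_left 1) (at_left 1)"
      by real_asymp
    hence "((\<lambda>r. r * integral_mean p (r\<^sup>2) ?k) \<longlongrightarrow> 1 * ?B) (at_left 1)"
      by (intro tendsto_mult filterlim_compose[OF mean_k] tendsto_ident_at)
    hence "((\<lambda>r. r * integral_mean p (r\<^sup>2) ?k) \<longlongrightarrow> ?B) (at_left 1)"
      by simp
    moreover have "\<forall>\<^sub>F r in at_left 1.
        r * integral_mean p (r\<^sup>2) ?k = integral_mean p r (\<lambda>z. f z + g z)"
      using unit
    proof eventually_elim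
      case (elim r)
      have "norm (f z + g z) = norm (of_real r * ?k (z\<^sup>2))" if z: "norm z = r" for z
      proof -
        have "z \<in> ball 0 1"
          using z elim by simp
        \<comment> \<open>The factor \<open>z\<close> is not a function of \<open>z\<^sup>2\<close>, but its modulus is constant on the circle.\<close>
        hence "f z + g z = z * ?k (z\<^sup>2)"
          using nz[of z] nz[of "z\<^sup>2"]
          by (simp add: f g norm_power power_less_one_iff abs_square_less_1 divide_simps)
             (simp add: power2_eq_square algebra_simps)
        thus ?thesis
          using z elim by (simp add: norm_mult norm_divide)
      qed
      hence "integral_mean p r (\<lambda>z. f z + g z) = integral_mean p r (\<lambda>z. of_real r * ?k (z\<^sup>2))"
        using elim by (intro integral_mean_cong) auto
      also have "\<dots> = r * integral_mean p r (\<lambda>z. ?k (z\<^sup>2))"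
        using elim p by (subst integral_mean_cmult) auto
      also have "integral_mean p r (\<lambda>z. ?k (z\<^sup>2)) = integral_mean p (r\<^sup>2) ?k"
        using elim p by (intro integral_mean_compose_square cont) auto
      finally show ?case ..
    qed
    ultimately show "((\<lambda>r. integral_mean p r (\<lambda>z. f z + g z)) \<longlongrightarrow> ?B) (at_left 1)"
      by (rule Lim_transform_eventually)
  qed

  have "?f holomorphic_on ball 0 1" "(\<lambda>z. - ((1 - z) / (1 + z))) holomorphic_on ball 0 1"
    using nz by (auto intro!: holomorphic_intros)
  hence "f holomorphic_on ball 0 1" "g holomorphic_on ball 0 1"
    by (auto intro: holomorphic_transform simp: f g)
  hence "f \<in> hardy_space p" "g \<in> hardy_space p"
    by (simp_all add: hardy_space_def norm_f norm_g)
  moreover have "hardy_norm p f + hardy_norm p g < hardy_norm p (\<lambda>z. f z + g z)"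
  proof -
    have "0 \<le> ?A"
      by (simp add: integral_mean_def)
    thus ?thesis
      using boundary_mean_less[OF p]
      by (simp add: norm_f norm_g norm_sum ennreal_less_iff flip: ennreal_plus)
  qed
  ultimately show ?thesis
    using g by blast
qed

end
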